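(* Let $K$ be a field of characteristic $0$. For every $n\ge2$, neither $\mathcal V_n^+$ nor $\mathcal V_n^-$ is a faithful $\mathcal P_n^\Phi$-module. Consequently, neither $\mathcal V^+$ nor $\mathcal V^-$ is a faithful $\mathcal P^\Phi$-module.
   Context: **Twisted partition category.** $\mathbb N=\{0,1,2,\ldots\}$, $[n]=\{1,\ldots,n\}$. For $A\subseteq\mathbb N$, $A'$ and $A''$ are disjoint copies of $A$. $\mathcal P_{m,n}$ is the set of all set partitions of $[m]\cup[n]'$; elements of $a$ are called $a$-blocks, and $a$ is identified with any graph whose connected components are its blocks. For $a\in\mathcal P_{m,n}$, $b\in\mathcal P_{n,t}$, the product graph $\Pi(a,b)$ has vertex set $[m]\cup[n]''\cup[t]'$ and edges those of $a$ (lower vertices $x'$ renamed $x''$) and of $b$ (upper vertices $x$ renamed $x''$). $ab\in\mathcal P_{m,t}$ is the partition in which $x,y\in[m]\cup[t]'$ are in the same block iff they are in the same component of $\Pi(a,b)$. $\Phi(a,b)$ is the number of connected components of $\Pi(a,b)$ contained in $[n]''$. $\mathcal P^\Phi$ is the category with objects $\mathbb N$, hom-sets $\mathcal P^\Phi_{m,n}=\mathbb N\times\mathcal P_{m,n}$, composition $(i,a)(j,b)=(i+j+\Phi(a,b),ab)$, and identities $(0,\iota_n)$ with $\iota_n=\{\{i,i'\}:i\in[n]\}$; $\mathcal P^\Phi_n=\mathcal P^\Phi_{n,n}$ is the twisted partition monoid. For $a\in\mathcal P_{m,n}$, $\overline a$ is the $2^m\times2^n$ matrix over $K$, rows and columns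 indexed by subsets of $[m]$ and $[n]$, with $\overline a_{X,Y}=1$ if $X\cup Y'$ is a (possibly empty) union of $a$-blocks, and $0$ otherwise. **The modules.** $\mathcal V_n=K^{2^n}$ (column vectors indexed by subsets of $[n]$) with standard basis $\{v_{n,X}:X\subseteq[n]\}$. $\mathcal P^\Phi$ acts on the family $\mathcal V=(\mathcal V_n)_{n\in\mathbb N}$ by $(i,a)\cdot v=2^i\,\overline a\,v\in\mathcal V_m$ for $(i,a)\in\mathcal P^\Phi_{m,n}$, $v\in\mathcal V_n$; in particular $\mathcal P_n^\Phi$ acts on $\mathcal V_n$. With $X^c=[n]\setminus X$, put $\mathcal V_n^+=\mathrm{span}_K\{v_{n,X}+v_{n,X^c}:X\subseteq[n]\}$ and $\mathcal V_n^-=\mathrm{span}_K\{v_{n,X}-v_{n,X^c}:X\subseteq[n]\}$, which are preserved by the action of $\mathcal P_n^\Phi$; $\mathcal V^\pm=(\mathcal V_n^\pm)_{n\in\mathbb N}$ are preserved by the action of $\mathcal P^\Phi$. A module is faithful if distinct elements of the monoid (respectively, distinct morphisms in the same hom-set of the category) act as distinct linear maps. *)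

theory Defs
  imports
    Complex_Main
    "HOL-Algebra.Group"
    "HOL-Library.Disjoint_Sets"
    "HOL-Library.Function_Algebras"
begin

section \<open>Partitions and their products\<close>

text \<open>
  The disjoint copies of the natural numbers: \<open>Up x\<close> is \<open>x\<close>, \<open>Low x\<close> is \<open>x'\<close>, and
  \<open>Mid x\<close> is the vertex \<open>x''\<close>, which occurs in product graphs only.
\<close>

datatype vertex = Up nat | Mid nat | Low nat

definition outer_vertices :: "nat \<Rightarrow> nat \<Rightarrow> vertex set" where
  "outer_vertices m n = Up ` {1..m} \<union> Low ` {1..n}"

definition partitions :: "nat \<Rightarrow> nat \<Rightarrow> vertex set set set" where
  "partitions m n = {a. partition_on (outer_vertices m n) a}"

text \<open>
  Among the graphs whose connected components are the blocks of \<open>a\<close> we use the one in which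
  every block is a clique.
\<close>

definition block_edges :: "vertex set set \<Rightarrow> (vertex \<times> vertex) set" where
  "block_edges a = {(x, y). \<exists>A\<in>a. x \<in> A \<and> y \<in> A}"

fun low_to_mid :: "vertex \<Rightarrow> vertex" where
  "low_to_mid (Low x) = Mid x"
| "low_to_mid (Up x) = Up x"
| "low_to_mid (Mid x) = Mid x"

fun up_to_mid :: "vertex \<Rightarrow> vertex" where
  "up_to_mid (Up x) = Mid x"
| "up_to_mid (Low x) = Low x"
| "up_to_mid (Mid x) = Mid x"

definition product_vertices :: "nat \<Rightarrow> nat \<Rightarrow> nat \<Rightarrow> vertex set" where
  "product_vertices m n t = Up ` {1..m} \<union> Mid ` {1..n} \<union> Low ` {1..t}"

definition product_edges :: "vertex set set \<Rightarrow> vertex set set \<Rightarrow> (vertex \<times> vertex) set" where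
  "product_edges a b =
     map_prod low_to_mid low_to_mid ` block_edges a \<union> map_prod up_to_mid up_to_mid ` block_edges b"

text \<open>The edge relation is symmetric, so its reflexive transitive closure is connectedness.\<close>

definition product_components ::
    "nat \<Rightarrow> nat \<Rightarrow> nat \<Rightarrow> vertex set set \<Rightarrow> vertex set set \<Rightarrow> vertex set set" where
  "product_components m n t a b = product_vertices m n t // (product_edges a b)\<^sup>*"

definition partition_mult ::
    "nat \<Rightarrow> nat \<Rightarrow> vertex set set \<Rightarrow> vertex set set \<Rightarrow> vertex set set" where
  "partition_mult m t a b =
     outer_vertices m t //
       {(x, y). x \<in> outer_vertices m t \<and> y \<in> outer_vertices m t \<and> (x, y) \<in> (product_edges a b)\<^sup>*}"

definition floating ::
    "nat \<Rightarrow> nat \<Rightarrow> nat \<Rightarrow> vertex set set \<Rightarrow> vertex set set \<Rightarrow> nat" where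
  "floating m n t a b = card {C \<in> product_components m n t a b. C \<subseteq> Mid ` {1..n}}"

definition id_partition :: "nat \<Rightarrow> vertex set set" where
  "id_partition n = (\<lambda>i. {Up i, Low i}) ` {1..n}"


section \<open>The twisted partition category and its endomorphism monoids\<close>

text \<open>
  \<open>Comp C m n t f g\<close> is the composite \<open>fg\<close>, written from left to right, of \<open>f \<in> Hom C m n\<close>
  and \<open>g \<in> Hom C n t\<close>.
\<close>

record ('o, 'f) category =
  Obj :: "'o set"
  Hom :: "'o \<Rightarrow> 'o \<Rightarrow> 'f set"
  Comp :: "'o \<Rightarrow> 'o \<Rightarrow> 'o \<Rightarrow> 'f \<Rightarrow> 'f \<Rightarrow> 'f"
  Ident :: "'o \<Rightarrow> 'f"

type_synonym twisted_partition = "nat \<times> vertex set set"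

definition twisted_partition_category :: "(nat, twisted_partition) category" where
  "twisted_partition_category =
     \<lparr>Obj = UNIV,
      Hom = (\<lambda>m n. UNIV \<times> partitions m n),
      Comp = (\<lambda>m n t (i, a) (j, b). (i + j + floating m n t a b, partition_mult m t a b)),
      Ident = (\<lambda>n. (0, id_partition n))\<rparr>"

definition endo_monoid :: "('o, 'f) category \<Rightarrow> 'o \<Rightarrow> 'f monoid" where
  "endo_monoid C n = \<lparr>carrier = Hom C n n, monoid.mult = Comp C n n n, one = Ident C n\<rparr>"

definition twisted_partition_monoid :: "nat \<Rightarrow> twisted_partition monoid" where
  "twisted_partition_monoid n = endo_monoid twisted_partition_category n"


section \<open>The modules\<close>

text \<open>
  A vector indexed by the subsets of \<open>{1..n}\<close> is a function on all sets of natural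
  numbers that vanishes at every set not contained in \<open>{1..n}\<close>.
\<close>

type_synonym 'k subset_vector = "nat set \<Rightarrow> 'k"

definition vscale :: "'k::field \<Rightarrow> 'k subset_vector \<Rightarrow> 'k subset_vector" where
  "vscale c v = (\<lambda>X. c * v X)"

global_interpretation subset_vectors: vector_space vscale
  by standard (auto simp: vscale_def fun_eq_iff algebra_simps)

definition basis_vector :: "nat set \<Rightarrow> 'k::field subset_vector" where
  "basis_vector X = (\<lambda>Y. if Y = X then 1 else 0)"

definition V_space :: "nat \<Rightarrow> 'k::field subset_vector set" where
  "V_space n = subset_vectors.span {basis_vector X | X. X \<subseteq> {1..n}}"

definition V_plus :: "nat \<Rightarrow> 'k::field subset_vector set" where
  "V_plus n = subset_vectors.span {basis_vector X + basis_vector ({1..n} - X) | X. X \<subseteq> {1..n}}"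

definition V_minus :: "nat \<Rightarrow> 'k::field subset_vector set" where
  "V_minus n = subset_vectors.span {basis_vector X - basis_vector ({1..n} - X) | X. X \<subseteq> {1..n}}"

definition partition_matrix :: "vertex set set \<Rightarrow> nat set \<Rightarrow> nat set \<Rightarrow> 'k::field" where
  "partition_matrix a X Y = (if \<exists>B\<subseteq>a. Up ` X \<union> Low ` Y = \<Union>B then 1 else 0)"

definition twisted_action ::
    "nat \<Rightarrow> nat \<Rightarrow> twisted_partition \<Rightarrow> 'k::field subset_vector \<Rightarrow> 'k subset_vector" where
  "twisted_action m n = (\<lambda>(i, a) v X.
     if X \<subseteq> {1..m} then 2 ^ i * (\<Sum>Y\<in>Pow {1..n}. partition_matrix a X Y * v Y) else 0)"

text \<open>
  Faithfulness compares the maps restricted to the module in question. A category module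
  assigns to each object \<open>n\<close> a set \<open>V n\<close> and to each \<open>f \<in> Hom C m n\<close> a map \<open>act m n f\<close> from
  \<open>V n\<close> to \<open>V m\<close>.
\<close>

definition faithful_monoid_module ::
    "('f, 'r) monoid_scheme \<Rightarrow> ('f \<Rightarrow> 'v \<Rightarrow> 'v) \<Rightarrow> 'v set \<Rightarrow> bool" where
  "faithful_monoid_module M act V \<longleftrightarrow> inj_on (\<lambda>f. restrict (act f) V) (carrier M)"

definition faithful_category_module ::
    "('o, 'f, 'r) category_scheme \<Rightarrow> ('o \<Rightarrow> 'o \<Rightarrow> 'f \<Rightarrow> 'v \<Rightarrow> 'v) \<Rightarrow> ('o \<Rightarrow> 'v set) \<Rightarrow> bool" where
  "faithful_category_module C act V \<longleftrightarrow>
     (\<forall>m\<in>Obj C. \<forall>n\<in>Obj C. inj_on (\<lambda>f. restrict (act m n f) (V n)) (Hom C m n))"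


section \<open>The action is well defined\<close>

lemma union_of_blocks_iff:
  assumes "a \<in> partitions m n"
  shows "(\<exists>B\<subseteq>a. S = \<Union>B) \<longleftrightarrow>
    S \<subseteq> outer_vertices m n \<and> (\<forall>x y. (x, y) \<in> block_edges a \<longrightarrow> x \<in> S \<longrightarrow> y \<in> S)"
proof
  have p: "\<Union>a = outer_vertices m n" "\<And>A B. A \<in> a \<Longrightarrow> B \<in> a \<Longrightarrow> A \<noteq> B \<Longrightarrow> A \<inter> B = {}"
    using assms by (auto simp: partitions_def partition_on_def disjoint_def)
  {
    assume "\<exists>B\<subseteq>a. S = \<Union>B"
    then obtain B where B: "B \<subseteq> a" "S = \<Union>B" by blast
    have "y \<in> S" if xy: "(x, y) \<in> block_edges a" "x \<in> S" for x y
    proof -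
      obtain A where "A \<in> a" "x \<in> A" "y \<in> A" using xy by (auto simp: block_edges_def)
      moreover obtain A' where "A' \<in> B" "x \<in> A'" using xy B by blast
      ultimately have "A = A'" using p(2)[of A A'] B by blast
      then show ?thesis using \<open>A' \<in> B\<close> \<open>y \<in> A\<close> B by blast
    qed
    then show "S \<subseteq> outer_vertices m n \<and> (\<forall>x y. (x, y) \<in> block_edges a \<longrightarrow> x \<in> S \<longrightarrow> y \<in> S)"
      using B p(1) by blast
  }
  assume S: "S \<subseteq> outer_vertices m n \<and> (\<forall>x y. (x, y) \<in> block_edges a \<longrightarrow> x \<in> S \<longrightarrow> y \<in> S)"
  have "S = \<Union>{A \<in> a. A \<subseteq> S}"
  proof (intro equalityI subsetI)
    fix x assume x: "x \<in> S"
    then obtain A where A: "A \<in> a" "x \<in> A" using S p(1) by blast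
    then have "A \<subseteq> S" using S x by (auto simp: block_edges_def)
    then show "x \<in> \<Union>{A \<in> a. A \<subseteq> S}" using A by blast
  qed blast
  then show "\<exists>B\<subseteq>a. S = \<Union>B" by (intro exI[of _ "{A \<in> a. A \<subseteq> S}"]) blast
qed

lemma block_edges_sym: "sym (block_edges a)"
  by (auto simp: sym_def block_edges_def)

lemma block_edges_outer:
  "a \<in> partitions m n \<Longrightarrow> (x, y) \<in> block_edges a \<Longrightarrow> x \<in> outer_vertices m n \<and> y \<in> outer_vertices m n"
  by (auto simp: partitions_def partition_on_def block_edges_def)

lemma product_edges_iff:
  "(x, y) \<in> product_edges a b \<longleftrightarrow>
    (\<exists>p q. (p, q) \<in> block_edges a \<and> x = low_to_mid p \<and> y = low_to_mid q) \<or>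
    (\<exists>p q. (p, q) \<in> block_edges b \<and> x = up_to_mid p \<and> y = up_to_mid q)"
  unfolding product_edges_def by (simp add: image_iff Bex_def)

lemma connected_equiv: "equiv UNIV ((product_edges a b)\<^sup>*)"
proof -
  have "sym (product_edges a b)"
    unfolding sym_def product_edges_iff
    using symD[OF block_edges_sym[of a]] symD[OF block_edges_sym[of b]] by blast
  then show ?thesis
    by (intro equivI refl_rtrancl sym_rtrancl trans_rtrancl) auto
qed

lemma connected_sym: "(x, y) \<in> (product_edges a b)\<^sup>* \<Longrightarrow> (y, x) \<in> (product_edges a b)\<^sup>*"
  using connected_equiv[of a b] unfolding equiv_def by (blast dest: symD)

lemma low_to_mid_in: "x \<in> outer_vertices m n \<Longrightarrow> low_to_mid x \<in> product_vertices m n t"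
  by (auto simp: outer_vertices_def product_vertices_def)

lemma up_to_mid_in: "x \<in> outer_vertices n t \<Longrightarrow> up_to_mid x \<in> product_vertices m n t"
  by (auto simp: outer_vertices_def product_vertices_def)

lemma connected_in_vertices:
  assumes "a \<in> partitions m n" "b \<in> partitions n t"
    and "(x, y) \<in> (product_edges a b)\<^sup>*" "x \<in> product_vertices m n t"
  shows "y \<in> product_vertices m n t"
  using assms(3,4)
proof (induction rule: rtrancl_induct)
  case base
  then show ?case .
next
  case (step y z)
  from step.hyps(2) show ?case
    unfolding product_edges_iff
    using block_edges_outer[OF assms(1)] block_edges_outer[OF assms(2)] low_to_mid_in up_to_mid_in
    by blast
qed

lemma outer_connected_equiv:
  "equiv (outer_vertices m t) {(x, y). x \<in> outer_vertices m t \<and> y \<in> outer_vertices m t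
    \<and> (x, y) \<in> (product_edges a b)\<^sup>*}" (is "equiv ?V ?r")
proof (intro equivI)
  show "?r \<subseteq> ?V \<times> ?V" "refl_on ?V ?r" by (auto simp: refl_on_def)
  show "sym ?r" using connected_sym by (simp add: sym_def)
  show "trans ?r"
  proof (rule transI)
    fix x y z assume "(x, y) \<in> ?r" "(y, z) \<in> ?r"
    then show "(x, z) \<in> ?r" using rtrancl_trans[of x y _ z] by simp
  qed
qed

lemma partition_mult_closed: "partition_mult m t a b \<in> partitions m t"
  unfolding partition_mult_def partitions_def
  by (simp add: partition_on_quotient outer_connected_equiv)

lemma block_edges_partition_mult:
  "(x, y) \<in> block_edges (partition_mult m t a b) \<longleftrightarrow>
    x \<in> outer_vertices m t \<and> y \<in> outer_vertices m t \<and> (x, y) \<in> (product_edges a b)\<^sup>*"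
    (is "_ \<longleftrightarrow> ?r")
proof
  note e = outer_connected_equiv[of m t a b]
  show ?r if "(x, y) \<in> block_edges (partition_mult m t a b)"
  proof -
    obtain A where "A \<in> partition_mult m t a b" "{x, y} \<subseteq> A"
      using \<open>(x, y) \<in> block_edges _\<close> by (auto simp: block_edges_def)
    then show ?thesis using in_quotient_imp_in_rel[OF e] unfolding partition_mult_def by blast
  qed
  assume r: ?r
  define A where "A = {(x, y). x \<in> outer_vertices m t \<and> y \<in> outer_vertices m t
    \<and> (x, y) \<in> (product_edges a b)\<^sup>*} `` {x}"
  have "A \<in> partition_mult m t a b"
    unfolding partition_mult_def A_def using r by (intro quotientI) simp
  moreover have "x \<in> A" "y \<in> A" using r by (simp_all add: A_def)
  ultimately show "(x, y) \<in> block_edges (partition_mult m t a b)"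
    unfolding block_edges_def by blast
qed

lemma id_partition_closed: "id_partition n \<in> partitions n n"
  unfolding id_partition_def partitions_def partition_on_def outer_vertices_def disjoint_def by auto

lemma partition_matrix_mult:
  assumes a: "a \<in> partitions m n" and b: "b \<in> partitions n t"
  shows "(\<Sum>Y\<in>Pow {1..n}. partition_matrix a X Y * partition_matrix b Y Z) =
    (2 ^ floating m n t a b * partition_matrix (partition_mult m t a b) X Z :: 'k::field)"
proof -
  let ?E = "product_edges a b" let ?R = "?E\<^sup>*"
  let ?S = "Up ` X \<union> Low ` Z"
  define T where "T Y = Up ` X \<union> Mid ` Y \<union> Low ` Z" for Y
  define F where "F = {C \<in> product_components m n t a b. C \<subseteq> Mid ` {1..n}}"
  define N where "N = {Y \<in> Pow {1..n}. (\<exists>B\<subseteq>a. Up ` X \<union> Low ` Y = \<Union>B) \<and> (\<exists>B\<subseteq>b. Up ` Y \<union> Low ` Z = \<Union>B)}"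
  have N_iff: "Y \<in> N \<longleftrightarrow> T Y \<subseteq> product_vertices m n t \<and> (\<forall>x y. (x, y) \<in> ?E \<longrightarrow> x \<in> T Y \<longrightarrow> y \<in> T Y)"
    (is "_ \<longleftrightarrow> ?r") for Y
  proof -
    have la: "low_to_mid x \<in> T Y \<longleftrightarrow> x \<in> Up ` X \<union> Low ` Y" if "x \<in> outer_vertices m n" for x
      using that by (auto simp: T_def outer_vertices_def)
    have lb: "up_to_mid x \<in> T Y \<longleftrightarrow> x \<in> Up ` Y \<union> Low ` Z" if "x \<in> outer_vertices n t" for x
      using that by (auto simp: T_def outer_vertices_def)
    have ea1: "(x \<in> Up ` X \<union> Low ` Y \<longrightarrow> y \<in> Up ` X \<union> Low ` Y) \<longleftrightarrow> (low_to_mid x \<in> T Y \<longrightarrow> low_to_mid y \<in> T Y)"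
      if "(x, y) \<in> block_edges a" for x y
      using block_edges_outer[OF a that] la by presburger
    have ea: "(\<forall>x y. (x, y) \<in> block_edges a \<longrightarrow> x \<in> Up ` X \<union> Low ` Y \<longrightarrow> y \<in> Up ` X \<union> Low ` Y) \<longleftrightarrow>
      (\<forall>x y. (x, y) \<in> block_edges a \<longrightarrow> low_to_mid x \<in> T Y \<longrightarrow> low_to_mid y \<in> T Y)"
      by (rule iff_allI, rule iff_allI, rule imp_cong[OF refl], rule ea1)
    have eb1: "(x \<in> Up ` Y \<union> Low ` Z \<longrightarrow> y \<in> Up ` Y \<union> Low ` Z) \<longleftrightarrow> (up_to_mid x \<in> T Y \<longrightarrow> up_to_mid y \<in> T Y)"
      if "(x, y) \<in> block_edges b" for x y
      using block_edges_outer[OF b that] lb by presburger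
    have eb: "(\<forall>x y. (x, y) \<in> block_edges b \<longrightarrow> x \<in> Up ` Y \<union> Low ` Z \<longrightarrow> y \<in> Up ` Y \<union> Low ` Z) \<longleftrightarrow>
      (\<forall>x y. (x, y) \<in> block_edges b \<longrightarrow> up_to_mid x \<in> T Y \<longrightarrow> up_to_mid y \<in> T Y)"
      by (rule iff_allI, rule iff_allI, rule imp_cong[OF refl], rule eb1)
    have e: "(\<forall>x y. (x, y) \<in> ?E \<longrightarrow> x \<in> T Y \<longrightarrow> y \<in> T Y) \<longleftrightarrow>
      (\<forall>x y. (x, y) \<in> block_edges a \<longrightarrow> low_to_mid x \<in> T Y \<longrightarrow> low_to_mid y \<in> T Y) \<and>
      (\<forall>x y. (x, y) \<in> block_edges b \<longrightarrow> up_to_mid x \<in> T Y \<longrightarrow> up_to_mid y \<in> T Y)"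
      unfolding product_edges_iff by blast
    have v: "T Y \<subseteq> product_vertices m n t \<longleftrightarrow> Y \<subseteq> {1..n} \<and>
      Up ` X \<union> Low ` Y \<subseteq> outer_vertices m n \<and> Up ` Y \<union> Low ` Z \<subseteq> outer_vertices n t"
      by (auto simp: T_def product_vertices_def outer_vertices_def)
    show ?thesis
      unfolding N_def mem_Collect_eq union_of_blocks_iff[OF a] union_of_blocks_iff[OF b] ea eb e v
      by (simp only: Pow_iff conj_ac)
  qed
  have R_closed: "y \<in> A" if "(x, y) \<in> ?R" "x \<in> A" "\<forall>x y. (x, y) \<in> ?E \<longrightarrow> x \<in> A \<longrightarrow> y \<in> A" for x y A
    using that by (induction rule: rtrancl_induct) auto
  have R_sym: "(y, x) \<in> ?R" if "(x, y) \<in> ?R" for x y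
    using that by (rule connected_sym)
  have F_class: "C = ?R `` {x}" if "C \<in> F" "x \<in> C" for C x
  proof -
    obtain z where z: "C = ?R `` {z}"
      using \<open>C \<in> F\<close> unfolding F_def product_components_def by (auto elim: quotientE)
    then have "(z, x) \<in> ?R" using \<open>x \<in> C\<close> by blast
    then show ?thesis unfolding z by (rule equiv_class_eq[OF connected_equiv])
  qed
  have F_ne: "C \<noteq> {}" if "C \<in> F" for C
    using that unfolding F_def product_components_def by (auto elim!: quotientE)
  have F_mid: "C \<subseteq> Mid ` {1..n}" if "C \<in> F" for C using that by (auto simp: F_def)
  have finF: "finite F"
    by (rule finite_subset[of _ "Pow (Mid ` {1..n})"]) (auto simp: F_def)
  have sum_N: "(\<Sum>Y\<in>Pow {1..n}. partition_matrix a X Y * partition_matrix b Y Z) = (of_nat (card N) :: 'k)"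
  proof -
    have "(\<Sum>Y\<in>Pow {1..n}. partition_matrix a X Y * partition_matrix b Y Z) =
      (\<Sum>Y\<in>Pow {1..n}. if Y \<in> N then 1 else 0 :: 'k)"
      by (intro sum.cong) (auto simp: partition_matrix_def N_def)
    also have "\<dots> = (\<Sum>Y\<in>Pow {1..n} \<inter> N. 1)" by (subst sum.inter_restrict) auto
    also have "Pow {1..n} \<inter> N = N" by (auto simp: N_def)
    finally show ?thesis by simp
  qed
  let ?ab = "partition_mult m t a b"
  have ab_iff: "(\<exists>B\<subseteq>?ab. ?S = \<Union>B) \<longleftrightarrow> ?S \<subseteq> outer_vertices m t \<and>
      (\<forall>x y. x \<in> ?S \<longrightarrow> y \<in> outer_vertices m t \<longrightarrow> (x, y) \<in> ?R \<longrightarrow> y \<in> ?S)"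
    unfolding union_of_blocks_iff[OF partition_mult_closed] block_edges_partition_mult by blast
  show ?thesis
  proof (cases "\<exists>B\<subseteq>?ab. ?S = \<Union>B")
    case False
    have "N = {}"
    proof (rule ccontr)
      assume "N \<noteq> {}"
      then obtain Y where Y: "Y \<in> N" by blast
      have "?S \<subseteq> outer_vertices m t"
        using Y unfolding N_iff by (auto simp: T_def product_vertices_def outer_vertices_def)
      moreover have "y \<in> ?S" if "x \<in> ?S" "y \<in> outer_vertices m t" "(x, y) \<in> ?R" for x y
      proof -
        have "x \<in> T Y" using that(1) by (auto simp: T_def)
        moreover have "\<forall>x y. (x, y) \<in> ?E \<longrightarrow> x \<in> T Y \<longrightarrow> y \<in> T Y" using Y unfolding N_iff ..
        ultimately have "y \<in> T Y" by (rule R_closed[OF that(3)])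
        then show ?thesis using that(2) by (auto simp: T_def outer_vertices_def)
      qed
      ultimately show False using False unfolding ab_iff by blast
    qed
    moreover have "partition_matrix ?ab X Z = (0 :: 'k)"
      unfolding partition_matrix_def by (rule if_not_P[OF False])
    ultimately show ?thesis unfolding sum_N by simp
  next
    case True
    note S' = True[unfolded ab_iff]
    have S: "?S \<subseteq> outer_vertices m t" using S' ..
    have S2: "y \<in> ?S" if "x \<in> ?S" "y \<in> outer_vertices m t" "(x, y) \<in> ?R" for x y
      using S'[THEN conjunct2, rule_format, OF that] .
    define f where "f G = {y. Mid y \<in> ?R `` ?S \<union> \<Union>G}" for G
    have SV: "?S \<subseteq> product_vertices m n t"
      using S by (auto simp: outer_vertices_def product_vertices_def)
    have RS: "?R `` ?S \<subseteq> product_vertices m n t"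
      using connected_in_vertices[OF a b] SV by blast
    have Tf: "T (f G) = ?R `` ?S \<union> \<Union>G" if "G \<subseteq> F" for G
    proof (intro equalityI subsetI)
      fix x assume "x \<in> T (f G)"
      then show "x \<in> ?R `` ?S \<union> \<Union>G" by (auto simp: T_def f_def)
    next
      fix x assume x: "x \<in> ?R `` ?S \<union> \<Union>G"
      show "x \<in> T (f G)"
      proof (cases "\<exists>y. x = Mid y")
        case True then show ?thesis using x by (auto simp: T_def f_def)
      next
        case False
        then have "x \<notin> \<Union>G" using that F_mid by blast
        then have xR: "x \<in> ?R `` ?S" using x by blast
        then have "x \<in> product_vertices m n t" using RS by blast
        then have "x \<in> outer_vertices m t"
          using False by (auto simp: product_vertices_def outer_vertices_def)
        then have "x \<in> ?S" using xR S2 by blast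
        then show ?thesis by (auto simp: T_def)
      qed
    qed
    have "bij_betw f (Pow F) N"
    proof (intro bij_betw_imageI equalityI subsetI)
      have inF: "G = {C \<in> F. C \<subseteq> T (f G)}" if GF: "G \<subseteq> F" for G
      proof (intro equalityI subsetI)
        fix C assume "C \<in> G" then show "C \<in> {C \<in> F. C \<subseteq> T (f G)}" using Tf[OF that] that by blast
      next
        fix C assume C: "C \<in> {C \<in> F. C \<subseteq> T (f G)}"
        then obtain x where x: "x \<in> C" using F_ne by blast
        have "x \<notin> ?R `` ?S"
        proof
          assume "x \<in> ?R `` ?S"
          then obtain s where s: "s \<in> ?S" "(s, x) \<in> ?R" by blast
          then have "s \<in> C" using F_class[of C x] C x R_sym by blast
          then show False using F_mid[of C] C s(1) by auto
        qed
        then obtain C' where C': "C' \<in> G" "x \<in> C'" using C x Tf[OF GF] by blast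
        then have "C = C'" using F_class[of C x] F_class[of C' x] C x that by blast
        then show "C \<in> G" using C' by simp
      qed
      show "inj_on f (Pow F)"
      proof (rule inj_onI)
        fix G H assume "G \<in> Pow F" "H \<in> Pow F" "f G = f H"
        then show "G = H" using inF[of G] inF[of H] by simp
      qed
    next
      fix Y assume "Y \<in> f ` Pow F"
      then obtain G where G: "G \<subseteq> F" "Y = f G" by blast
      have "\<Union>G \<subseteq> product_vertices m n t" using G(1) F_mid by (auto simp: product_vertices_def)
      moreover have "y \<in> ?R `` ?S \<union> \<Union>G" if xy: "(x, y) \<in> ?E" "x \<in> ?R `` ?S \<union> \<Union>G" for x y
      proof (cases "x \<in> ?R `` ?S")
        case True
        then show ?thesis using that(1) by (blast intro: rtrancl_into_rtrancl)
      next
        case False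
        then obtain C where "C \<in> G" "x \<in> C" using xy by blast
        then show ?thesis using F_class[of C x] G(1) that(1) by blast
      qed
      ultimately show "Y \<in> N" using RS unfolding N_iff G(2) Tf[OF G(1)] by blast
    next
      fix Y assume "Y \<in> N"
      then have Y: "T Y \<subseteq> product_vertices m n t" "\<forall>x y. (x, y) \<in> ?E \<longrightarrow> x \<in> T Y \<longrightarrow> y \<in> T Y"
        unfolding N_iff by blast+
      define G where "G = {C \<in> F. C \<subseteq> T Y}"
      have "T Y = ?R `` ?S \<union> \<Union>G"
      proof (intro equalityI subsetI)
        fix x assume x: "x \<in> T Y"
        have cl: "?R `` {x} \<subseteq> T Y" using R_closed[OF _ x Y(2)] by blast
        show "x \<in> ?R `` ?S \<union> \<Union>G"
        proof (cases "?R `` {x} \<subseteq> Mid ` {1..n}")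
          case True
          have "x \<in> product_vertices m n t" using x Y(1) by blast
          then have "?R `` {x} \<in> G"
            using cl True by (auto simp: G_def F_def product_components_def intro: quotientI)
          then show ?thesis by blast
        next
          case False
          then obtain u where u: "(x, u) \<in> ?R" "u \<notin> Mid ` {1..n}" by blast
          then have "u \<in> T Y" "u \<in> product_vertices m n t" using cl Y(1) by blast+
          then have "u \<in> ?S" using u(2) by (auto simp: T_def product_vertices_def)
          then show ?thesis using R_sym[OF u(1)] by blast
        qed
      next
        fix x assume "x \<in> ?R `` ?S \<union> \<Union>G"
        then consider (conn) u where "u \<in> ?S" "(u, x) \<in> ?R" | (float) "x \<in> \<Union>G" by blast
        then show "x \<in> T Y"
        proof cases
          case conn
          have "u \<in> T Y" using conn(1) by (auto simp: T_def)
          then show ?thesis using R_closed[OF conn(2) _ Y(2)] by blast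
        next
          case float
          then show ?thesis unfolding G_def by blast
        qed
      qed
      then have "f G = {y. Mid y \<in> T Y}" unfolding f_def by simp
      also have "\<dots> = Y" by (auto simp: T_def)
      finally have "f G = Y" .
      moreover have "G \<in> Pow F" by (auto simp: G_def)
      ultimately show "Y \<in> f ` Pow F" by blast
    qed
    then have "card N = 2 ^ card F" using bij_betw_same_card card_Pow[OF finF] by metis
    moreover have "partition_matrix ?ab X Z = (1 :: 'k)"
      unfolding partition_matrix_def by (rule if_P[OF True])
    moreover have "floating m n t a b = card F" unfolding floating_def F_def ..
    ultimately show ?thesis unfolding sum_N by simp
  qed
qed

lemma partition_matrix_eq_0:
  assumes "a \<in> partitions m n" "\<not> (X \<subseteq> {1..m} \<and> Y \<subseteq> {1..n})"
  shows "partition_matrix a X Y = 0"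
  using assms(2) unfolding partition_matrix_def union_of_blocks_iff[OF assms(1)]
  by (auto simp: outer_vertices_def)

lemma partition_matrix_compl:
  assumes a: "a \<in> partitions m n" and "X \<subseteq> {1..m}" "Y \<subseteq> {1..n}"
  shows "partition_matrix a ({1..m} - X) ({1..n} - Y) = partition_matrix a X Y"
proof -
  let ?S = "Up ` X \<union> Low ` Y" and ?T = "Up ` ({1..m} - X) \<union> Low ` ({1..n} - Y)"
  have T: "?T = outer_vertices m n - ?S" by (auto simp: outer_vertices_def)
  have S: "?S \<subseteq> outer_vertices m n" using assms by (auto simp: outer_vertices_def)
  have closed: "\<forall>x y. (x, y) \<in> block_edges a \<longrightarrow> x \<in> outer_vertices m n - R \<longrightarrow> y \<in> outer_vertices m n - R"
    if R: "\<forall>x y. (x, y) \<in> block_edges a \<longrightarrow> x \<in> R \<longrightarrow> y \<in> R" for R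
  proof (intro allI impI)
    fix x y assume xy: "(x, y) \<in> block_edges a" "x \<in> outer_vertices m n - R"
    then have "(y, x) \<in> block_edges a" using symD[OF block_edges_sym] by blast
    then show "y \<in> outer_vertices m n - R" using R xy block_edges_outer[OF a xy(1)] by blast
  qed
  have "(\<exists>B\<subseteq>a. ?T = \<Union>B) \<longleftrightarrow> (\<exists>B\<subseteq>a. ?S = \<Union>B)"
    unfolding union_of_blocks_iff[OF a] T
  proof
    assume "outer_vertices m n - ?S \<subseteq> outer_vertices m n \<and> (\<forall>x y. (x, y) \<in> block_edges a \<longrightarrow>
      x \<in> outer_vertices m n - ?S \<longrightarrow> y \<in> outer_vertices m n - ?S)"
    from closed[OF conjunct2[OF this]]
    show "?S \<subseteq> outer_vertices m n \<and>
      (\<forall>x y. (x, y) \<in> block_edges a \<longrightarrow> x \<in> ?S \<longrightarrow> y \<in> ?S)"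
      unfolding double_diff[OF S subset_refl] using S by (rule conjI[rotated])
  next
    assume "?S \<subseteq> outer_vertices m n \<and> (\<forall>x y. (x, y) \<in> block_edges a \<longrightarrow> x \<in> ?S \<longrightarrow> y \<in> ?S)"
    from closed[OF conjunct2[OF this]]
    show "outer_vertices m n - ?S \<subseteq> outer_vertices m n \<and> (\<forall>x y. (x, y) \<in> block_edges a \<longrightarrow>
      x \<in> outer_vertices m n - ?S \<longrightarrow> y \<in> outer_vertices m n - ?S)"
      by (rule conjI[OF Diff_subset])
  qed
  then show ?thesis unfolding partition_matrix_def by simp
qed

lemma twisted_action_comp:
  assumes "f \<in> Hom twisted_partition_category m n" "g \<in> Hom twisted_partition_category n t"
  shows "twisted_action m t (Comp twisted_partition_category m n t f g) v =
    twisted_action m n f (twisted_action n t g v)"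
proof -
  obtain i a j b where f: "f = (i, a)" and g: "g = (j, b)" by (cases f, cases g) auto
  have a: "a \<in> partitions m n" and b: "b \<in> partitions n t"
    using assms by (auto simp: twisted_partition_category_def f g)
  have key: "(\<Sum>Y\<in>Pow {1..n}. partition_matrix a X Y *
      (2 ^ j * (\<Sum>Z\<in>Pow {1..t}. partition_matrix b Y Z * v Z))) =
    2 ^ j * (\<Sum>Z\<in>Pow {1..t}. 2 ^ floating m n t a b * partition_matrix (partition_mult m t a b) X Z * v Z)"
    for X
    unfolding partition_matrix_mult[OF a b, symmetric] sum_distrib_left sum_distrib_right
    by (subst sum.swap) (simp only: mult_ac)
  show ?thesis
  proof
    fix X
    have "twisted_action m n f (twisted_action n t g v) X =
      (if X \<subseteq> {1..m} then 2 ^ i * (\<Sum>Y\<in>Pow {1..n}. partition_matrix a X Y *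
        (2 ^ j * (\<Sum>Z\<in>Pow {1..t}. partition_matrix b Y Z * v Z))) else 0)"
      by (auto simp: twisted_action_def f g intro!: sum.cong)
    then show "twisted_action m t (Comp twisted_partition_category m n t f g) v X =
      twisted_action m n f (twisted_action n t g v) X"
      unfolding key
      by (simp add: twisted_action_def twisted_partition_category_def f g power_add
        sum_distrib_left mult_ac)
  qed
qed

lemma twisted_action_id:
  fixes v :: "'k::field subset_vector"
  assumes "v \<in> V_space n"
  shows "twisted_action n n (Ident twisted_partition_category n) v = v"
proof -
  have v0: "v X = 0" if X: "\<not> X \<subseteq> {1..n}" for X
    using assms unfolding V_space_def
  proof (induction rule: subset_vectors.span_induct_alt)
    case base
    show ?case by simp
  next
    case (step c x y)
    then obtain Z where "x = basis_vector Z" "X \<noteq> Z" using X by blast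
    then show ?case using step.IH by (simp add: vscale_def basis_vector_def)
  qed
  have "(\<exists>B\<subseteq>id_partition n. Up ` X \<union> Low ` Y = \<Union>B) \<longleftrightarrow> X = Y"
    if X: "X \<subseteq> {1..n}" and Y: "Y \<subseteq> {1..n}" for X Y
  proof
    have e: "(Up k, Low k) \<in> block_edges (id_partition n)" "(Low k, Up k) \<in> block_edges (id_partition n)"
      if "k \<in> {1..n}" for k
      using that by (auto simp: block_edges_def id_partition_def)
    assume "\<exists>B\<subseteq>id_partition n. Up ` X \<union> Low ` Y = \<Union>B"
    from conjunct2[OF this[unfolded union_of_blocks_iff[OF id_partition_closed]]]
    have c: "w \<in> Up ` X \<union> Low ` Y"
      if "(z, w) \<in> block_edges (id_partition n)" "z \<in> Up ` X \<union> Low ` Y" for z w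
      using that by blast
    show "X = Y"
    proof (intro equalityI subsetI)
      fix k assume "k \<in> X" then show "k \<in> Y" using c[OF e(1)[of k]] X by auto
    next
      fix k assume "k \<in> Y" then show "k \<in> X" using c[OF e(2)[of k]] Y by auto
    qed
  next
    assume "X = Y"
    then have "Up ` X \<union> Low ` Y = \<Union>((\<lambda>i. {Up i, Low i}) ` X)" by auto
    moreover have "(\<lambda>i. {Up i, Low i}) ` X \<subseteq> id_partition n"
      unfolding id_partition_def using X by (rule image_mono)
    ultimately show "\<exists>B\<subseteq>id_partition n. Up ` X \<union> Low ` Y = \<Union>B" by blast
  qed
  then have m: "partition_matrix (id_partition n) X Y = (if X = Y then 1 else 0 :: 'k)"
    if "X \<subseteq> {1..n}" "Y \<subseteq> {1..n}" for X Y
    using that unfolding partition_matrix_def by simp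
  show ?thesis
  proof
    fix X
    have "(\<Sum>Y\<in>Pow {1..n}. partition_matrix (id_partition n) X Y * v Y) = v X" if "X \<subseteq> {1..n}"
    proof -
      have "(\<Sum>Y\<in>Pow {1..n}. partition_matrix (id_partition n) X Y * v Y) =
          (\<Sum>Y\<in>Pow {1..n}. if X = Y then v Y else 0)"
        by (intro sum.cong refl) (use that m in auto)
      also have "\<dots> = v X" using that by simp
      finally show ?thesis .
    qed
    then show "twisted_action n n (Ident twisted_partition_category n) v X = v X"
      using v0[of X] by (simp add: twisted_action_def twisted_partition_category_def)
  qed
qed

lemma twisted_action_linear:
  "twisted_action m n f (v + w) = twisted_action m n f v + twisted_action m n f w"
  "twisted_action m n f (vscale c v) = vscale c (twisted_action m n f v)"
  by (auto simp: twisted_action_def vscale_def fun_eq_iff algebra_simps sum.distrib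
    sum_distrib_left split: prod.splits)

lemma signed_span_iff:
  fixes v :: "'k::field_char_0 subset_vector"
  assumes s: "s * s = 1"
  shows "v \<in> subset_vectors.span
      {basis_vector X + vscale s (basis_vector ({1..n} - X)) | X. X \<subseteq> {1..n}} \<longleftrightarrow>
    (\<forall>X. \<not> X \<subseteq> {1..n} \<longrightarrow> v X = 0) \<and> (\<forall>X\<subseteq>{1..n}. v ({1..n} - X) = s * v X)"
    (is "v \<in> subset_vectors.span ?G \<longleftrightarrow> _")
proof
  assume "v \<in> subset_vectors.span ?G"
  then show "(\<forall>X. \<not> X \<subseteq> {1..n} \<longrightarrow> v X = 0) \<and> (\<forall>X\<subseteq>{1..n}. v ({1..n} - X) = s * v X)"
  proof (induction rule: subset_vectors.span_induct_alt)
    case base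
    then show ?case by simp
  next
    case (step c x y)
    then obtain Z where Z: "Z \<subseteq> {1..n}" "x = basis_vector Z + vscale s (basis_vector ({1..n} - Z))"
      by blast
    have "x X = 0" if "\<not> X \<subseteq> {1..n}" for X
      using that Z by (auto simp: basis_vector_def vscale_def)
    moreover have "x ({1..n} - X) = s * x X" if "X \<subseteq> {1..n}" for X
    proof -
      have "{1..n} - X = Z \<longleftrightarrow> X = {1..n} - Z" "{1..n} - X = {1..n} - Z \<longleftrightarrow> X = Z"
        using that Z(1) by blast+
      then show ?thesis using s by (simp add: Z(2) basis_vector_def vscale_def algebra_simps)
    qed
    ultimately show ?case using step.IH by (simp add: vscale_def algebra_simps)
  qed
next
  assume v: "(\<forall>X. \<not> X \<subseteq> {1..n} \<longrightarrow> v X = 0) \<and> (\<forall>X\<subseteq>{1..n}. v ({1..n} - X) = s * v X)"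
  let ?g = "\<lambda>X. basis_vector X + vscale s (basis_vector ({1..n} - X)) :: 'k subset_vector"
  let ?w = "\<Sum>X\<in>Pow {1..n}. vscale (v X / 2) (?g X)"
  have sum_apply: "(\<Sum>X\<in>A. h X) Y = (\<Sum>X\<in>A. h X Y)" for A Y and h :: "nat set \<Rightarrow> 'k subset_vector"
    by (induction A rule: infinite_finite_induct) auto
  have "v = ?w"
  proof
    fix Y
    show "v Y = ?w Y"
    proof (cases "Y \<subseteq> {1..n}")
      case False
      then show ?thesis using v
        unfolding sum_apply by (subst sum.neutral) (auto simp: vscale_def basis_vector_def)
    next
      case True
      have c: "Y = {1..n} - X \<longleftrightarrow> X = {1..n} - Y" if "X \<subseteq> {1..n}" for X
        using that True by blast
      have "?w Y = (\<Sum>X\<in>Pow {1..n}. (if X = Y then v X / 2 else 0)) +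
          (\<Sum>X\<in>Pow {1..n}. (if X = {1..n} - Y then v X * s / 2 else 0))"
        unfolding sum_apply sum.distrib[symmetric]
      proof (intro sum.cong refl)
        fix X assume "X \<in> Pow {1..n}"
        then have cX: "Y = {1..n} - X \<longleftrightarrow> X = {1..n} - Y" using c by blast
        have "vscale (v X / 2) (?g X) Y =
            v X / 2 * ((if Y = X then 1 else 0) + s * (if Y = {1..n} - X then 1 else 0))"
          by (simp add: vscale_def basis_vector_def)
        also have "\<dots> = (if X = Y then v X / 2 else 0) + (if X = {1..n} - Y then v X * s / 2 else 0)"
          unfolding cX eq_commute[of Y X]
          by (cases "X = Y"; cases "X = {1..n} - Y") (simp_all add: algebra_simps)
        finally show "vscale (v X / 2) (?g X) Y =
          (if X = Y then v X / 2 else 0) + (if X = {1..n} - Y then v X * s / 2 else 0)" .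
      qed
      also have "\<dots> = v Y / 2 + v ({1..n} - Y) * s / 2" using True by simp
      also have "v ({1..n} - Y) * s = v Y" using v True s by (simp add: mult_ac flip: mult.assoc)
      also have "v Y / 2 + v Y / 2 = v Y" by (simp add: field_simps)
      finally show ?thesis by (rule sym)
    qed
  qed
  also have "?w \<in> subset_vectors.span ?G"
    by (intro subset_vectors.span_sum subset_vectors.span_scale subset_vectors.span_base) blast
  finally show "v \<in> subset_vectors.span ?G" .
qed

lemma V_plus_iff:
  "(v :: 'k::field_char_0 subset_vector) \<in> V_plus n \<longleftrightarrow>
    (\<forall>X. \<not> X \<subseteq> {1..n} \<longrightarrow> v X = 0) \<and> (\<forall>X\<subseteq>{1..n}. v ({1..n} - X) = v X)"
  using signed_span_iff[of 1 v n] by (simp add: V_plus_def)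

lemma V_minus_iff:
  "(v :: 'k::field_char_0 subset_vector) \<in> V_minus n \<longleftrightarrow>
    (\<forall>X. \<not> X \<subseteq> {1..n} \<longrightarrow> v X = 0) \<and> (\<forall>X\<subseteq>{1..n}. v ({1..n} - X) = - v X)"
proof -
  have "basis_vector X - basis_vector Y = basis_vector X + vscale (- 1) (basis_vector Y :: 'k subset_vector)"
    for X Y
    by (simp add: vscale_def fun_eq_iff)
  then show ?thesis using signed_span_iff[of "- 1" v n] by (simp add: V_minus_def)
qed

lemma twisted_action_compl:
  assumes "f \<in> Hom twisted_partition_category m n" "X \<subseteq> {1..m}"
    and v: "\<And>Y. Y \<subseteq> {1..n} \<Longrightarrow> v ({1..n} - Y) = s * v Y"
  shows "twisted_action m n f v ({1..m} - X) = s * twisted_action m n f v X"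
proof -
  obtain i a where f: "f = (i, a)" by (cases f)
  have a: "a \<in> partitions m n" using assms(1) by (auto simp: twisted_partition_category_def f)
  have "(\<Sum>Y\<in>Pow {1..n}. partition_matrix a ({1..m} - X) Y * v Y) =
      (\<Sum>Y\<in>Pow {1..n}. partition_matrix a ({1..m} - X) ({1..n} - Y) * v ({1..n} - Y))"
    by (rule sum.reindex_bij_witness[of _ "\<lambda>Y. {1..n} - Y" "\<lambda>Y. {1..n} - Y"])
      (auto simp: double_diff)
  also have "\<dots> = s * (\<Sum>Y\<in>Pow {1..n}. partition_matrix a X Y * v Y)"
    unfolding sum_distrib_left
  proof (intro sum.cong refl)
    fix Y assume "Y \<in> Pow {1..n}"
    then have Y: "Y \<subseteq> {1..n}" by blast
    show "partition_matrix a ({1..m} - X) ({1..n} - Y) * v ({1..n} - Y) =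
        s * (partition_matrix a X Y * v Y)"
      unfolding partition_matrix_compl[OF a assms(2) Y] v[OF Y] by (rule mult.left_commute)
  qed
  finally have "2 ^ i * (\<Sum>Y\<in>Pow {1..n}. partition_matrix a ({1..m} - X) Y * v Y) =
      s * (2 ^ i * (\<Sum>Y\<in>Pow {1..n}. partition_matrix a X Y * v Y))"
    by (simp only: mult.left_commute)
  then show ?thesis
    unfolding twisted_action_def f using assms(2) by simp
qed

lemma twisted_action_V_plus:
  assumes "f \<in> Hom twisted_partition_category m n" "(v :: 'k::field_char_0 subset_vector) \<in> V_plus n"
  shows "twisted_action m n f v \<in> V_plus m"
  using assms twisted_action_compl[OF assms(1), of _ v 1]
  unfolding V_plus_iff by (auto simp: twisted_action_def split: prod.splits)

lemma twisted_action_V_minus: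
  assumes "f \<in> Hom twisted_partition_category m n" "(v :: 'k::field_char_0 subset_vector) \<in> V_minus n"
  shows "twisted_action m n f v \<in> V_minus m"
  using assms twisted_action_compl[OF assms(1), of _ v "- 1"]
  unfolding V_minus_iff by (auto simp: twisted_action_def split: prod.splits)

end

theory Submission
  imports Defs
begin

text \<open>
  Two partitions account for both failures of faithfulness: \<open>s = {[m], [n]'}\<close> and the one-block
  partition \<open>c = {[m] \<union> [n]'}\<close>, for positive \<open>m\<close> and \<open>n\<close>. The image of a vector \<open>v\<close> under either
  matrix is supported on the rows \<open>\<emptyset>\<close> and \<open>[m]\<close>. In both of these rows \<open>s\<close> gives
  \<open>v(\<emptyset>) + v([n])\<close>, whereas \<open>c\<close> gives \<open>v(\<emptyset>)\<close> and \<open>v([n])\<close> respectively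
  (lemmas \<open>twisted_action_split\<close> and \<open>twisted_action_joined\<close>).

  On \<open>\<V>\<^sup>+\<close> one has \<open>v(\<emptyset>) = v([n])\<close>, hence \<open>s\<close> acts as twice \<open>c\<close>. The twist by one
  floating component is also multiplication by 2, so \<open>(0, s)\<close> and \<open>(1, c)\<close> act as the same map. On
  \<open>\<V>\<^sup>-\<close> one has \<open>v(\<emptyset>) = - v([n])\<close>, hence \<open>s\<close> acts as zero, and \<open>(0, s)\<close> and
  \<open>(1, s)\<close> act as the same map. Since \<open>m = n\<close> is allowed, each pair collides in the
  endomorphism monoid of \<open>n\<close> and thereby also in the category.
\<close>

definition split_partition :: "nat \<Rightarrow> nat \<Rightarrow> vertex set set" where
  "split_partition m n = {Up ` {1..m}, Low ` {1..n}}"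

definition joined_partition :: "nat \<Rightarrow> nat \<Rightarrow> vertex set set" where
  "joined_partition m n = {outer_vertices m n}"

lemma split_partition_closed:
  assumes "0 < m" "0 < n"
  shows "split_partition m n \<in> partitions m n"
  using assms
  by (auto simp: split_partition_def partitions_def partition_on_def outer_vertices_def disjoint_def)

lemma joined_partition_closed:
  assumes "0 < m"
  shows "joined_partition m n \<in> partitions m n"
  using assms
  by (auto simp: joined_partition_def partitions_def partition_on_def outer_vertices_def disjoint_def)

lemma Up_Low_eq_iff:
  "Up ` X \<union> Low ` Y = Up ` X' \<union> Low ` Y' \<longleftrightarrow> X = X' \<and> Y = Y'"
  by (auto simp: set_eq_iff image_iff)

lemma partition_matrix_split:
  "partition_matrix (split_partition m n) X Y =
    (if X \<in> {{}, {1..m}} \<and> Y \<in> {{}, {1..n}} then 1 else 0)"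
proof -
  have "(\<exists>B\<subseteq>split_partition m n. S = \<Union>B) \<longleftrightarrow>
      S \<in> {{}, Up ` {1..m}, Low ` {1..n}, Up ` {1..m} \<union> Low ` {1..n}}" for S
    unfolding split_partition_def Pow_iff[symmetric] Bex_def[symmetric]
    by (simp add: Pow_insert Un_commute) blast
  then have "(\<exists>B\<subseteq>split_partition m n. Up ` X \<union> Low ` Y = \<Union>B) \<longleftrightarrow>
      X \<in> {{}, {1..m}} \<and> Y \<in> {{}, {1..n}}"
    using Up_Low_eq_iff[of X Y "{}" "{}"] Up_Low_eq_iff[of X Y "{1..m}" "{}"]
      Up_Low_eq_iff[of X Y "{}" "{1..n}"] Up_Low_eq_iff[of X Y "{1..m}" "{1..n}"]
    by auto
  then show ?thesis unfolding partition_matrix_def by simp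
qed

lemma partition_matrix_joined:
  "partition_matrix (joined_partition m n) X Y =
    (if X = {} \<and> Y = {} \<or> X = {1..m} \<and> Y = {1..n} then 1 else 0)"
proof -
  have "(\<exists>B\<subseteq>joined_partition m n. S = \<Union>B) \<longleftrightarrow> S \<in> {{}, Up ` {1..m} \<union> Low ` {1..n}}" for S
    by (auto simp: joined_partition_def outer_vertices_def subset_singleton_iff)
  then have "(\<exists>B\<subseteq>joined_partition m n. Up ` X \<union> Low ` Y = \<Union>B) \<longleftrightarrow>
      X = {} \<and> Y = {} \<or> X = {1..m} \<and> Y = {1..n}"
    using Up_Low_eq_iff[of X Y "{}" "{}"] Up_Low_eq_iff[of X Y "{1..m}" "{1..n}"] by auto
  then show ?thesis unfolding partition_matrix_def by simp
qed

text \<open>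
  Positivity of \<open>n\<close> makes \<open>\<emptyset>\<close> and \<open>[n]\<close> two different columns; for \<open>n = 0\<close> the row sum
  would be \<open>v(\<emptyset>)\<close> alone.
\<close>

lemma twisted_action_split:
  assumes "0 < n"
  shows "twisted_action m n (i, split_partition m n) v X =
    (if X \<in> {{}, {1..m}} then 2 ^ i * (v {} + v {1..n}) else 0)"
proof -
  have "(\<Sum>Y\<in>Pow {1..n}. partition_matrix (split_partition m n) X Y * v Y) = v {} + v {1..n}"
    if "X \<in> {{}, {1..m}}"
  proof -
    have "(\<Sum>Y\<in>Pow {1..n}. partition_matrix (split_partition m n) X Y * v Y) =
        (\<Sum>Y\<in>{{}, {1..n}}. v Y)"
      by (rule sum.mono_neutral_cong_right) (use that in \<open>auto simp: partition_matrix_split\<close>)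
    then show ?thesis using assms by simp
  qed
  moreover have "(\<Sum>Y\<in>Pow {1..n}. partition_matrix (split_partition m n) X Y * v Y) = 0"
    if "X \<notin> {{}, {1..m}}"
    by (rule sum.neutral) (use that in \<open>auto simp: partition_matrix_split\<close>)
  ultimately show ?thesis by (auto simp: twisted_action_def)
qed

lemma twisted_action_joined:
  assumes "0 < m"
  shows "twisted_action m n (i, joined_partition m n) v X =
    (if X = {} then 2 ^ i * v {} else if X = {1..m} then 2 ^ i * v {1..n} else 0)"
proof -
  \<comment> \<open>The only column in which row \<open>X\<close> of the matrix is nonzero.\<close>
  let ?Z = "if X = {} then {} else {1..n}"
  have "(\<Sum>Y\<in>Pow {1..n}. partition_matrix (joined_partition m n) X Y * v Y) = (\<Sum>Y\<in>{?Z}. v Y)"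
    if "X \<in> {{}, {1..m}}"
    by (rule sum.mono_neutral_cong_right)
      (use that assms in \<open>auto simp: partition_matrix_joined\<close>)
  moreover have "(\<Sum>Y\<in>Pow {1..n}. partition_matrix (joined_partition m n) X Y * v Y) = 0"
    if "X \<notin> {{}, {1..m}}"
    by (rule sum.neutral) (use that in \<open>auto simp: partition_matrix_joined\<close>)
  ultimately show ?thesis by (auto simp: twisted_action_def)
qed

lemma twisted_action_eq_on_V_plus:
  assumes "0 < m" "0 < n" "(v :: 'k::field_char_0 subset_vector) \<in> V_plus n"
  shows "twisted_action m n (0, split_partition m n) v =
    twisted_action m n (1, joined_partition m n) v"
proof -
  have "v {1..n} = v {}"
    using assms(3) unfolding V_plus_iff by (metis Diff_empty empty_subsetI)
  then show ?thesis
    using assms(1,2) by (auto simp: twisted_action_split twisted_action_joined)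
qed

lemma twisted_action_eq_on_V_minus:
  assumes "0 < n" "(v :: 'k::field_char_0 subset_vector) \<in> V_minus n"
  shows "twisted_action m n (i, split_partition m n) v =
    twisted_action m n (j, split_partition m n) v"
proof -
  have "v {1..n} = - v {}"
    using assms(2) unfolding V_minus_iff by (metis Diff_empty empty_subsetI)
  then show ?thesis
    using assms(1) by (auto simp: twisted_action_split)
qed

lemma not_inj_on_twisted_action_V_plus:
  assumes "0 < m" "0 < n"
  shows "\<not> inj_on (\<lambda>f. restrict (twisted_action m n f) (V_plus n :: 'k::field_char_0 subset_vector set))
    (Hom twisted_partition_category m n)"
proof
  assume "inj_on (\<lambda>f. restrict (twisted_action m n f) (V_plus n :: 'k subset_vector set))
    (Hom twisted_partition_category m n)"
  moreover have "restrict (twisted_action m n (0, split_partition m n)) (V_plus n :: 'k subset_vector set) =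
      restrict (twisted_action m n (1, joined_partition m n)) (V_plus n)"
    by (rule restrict_ext) (rule twisted_action_eq_on_V_plus[OF assms])
  ultimately have "(0, split_partition m n) = (1 :: nat, joined_partition m n)"
    by (rule inj_onD)
      (simp_all add: twisted_partition_category_def split_partition_closed joined_partition_closed assms)
  then show False by simp
qed

lemma not_inj_on_twisted_action_V_minus:
  assumes "0 < m" "0 < n"
  shows "\<not> inj_on (\<lambda>f. restrict (twisted_action m n f) (V_minus n :: 'k::field_char_0 subset_vector set))
    (Hom twisted_partition_category m n)"
proof
  assume "inj_on (\<lambda>f. restrict (twisted_action m n f) (V_minus n :: 'k subset_vector set))
    (Hom twisted_partition_category m n)"
  moreover have "restrict (twisted_action m n (0, split_partition m n)) (V_minus n :: 'k subset_vector set) =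
      restrict (twisted_action m n (1, split_partition m n)) (V_minus n)"
    by (rule restrict_ext) (rule twisted_action_eq_on_V_minus[OF assms(2)])
  ultimately have "(0, split_partition m n) = (1 :: nat, split_partition m n)"
    by (rule inj_onD) (simp_all add: twisted_partition_category_def split_partition_closed assms)
  then show False by simp
qed

theorem mainTheorem11:
  shows "(\<forall>n\<ge>2.
       \<not> faithful_monoid_module (twisted_partition_monoid n) (twisted_action n n)
           (V_plus n :: 'k::field_char_0 subset_vector set) \<and>
       \<not> faithful_monoid_module (twisted_partition_monoid n) (twisted_action n n)
           (V_minus n :: 'k subset_vector set)) \<and>
     \<not> faithful_category_module twisted_partition_category twisted_action
         (V_plus :: nat \<Rightarrow> 'k subset_vector set) \<and>
     \<not> faithful_category_module twisted_partition_category twisted_action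
         (V_minus :: nat \<Rightarrow> 'k subset_vector set)"
proof (intro conjI allI impI)
  fix n :: nat assume "2 \<le> n"
  then have n: "0 < n" by simp
  show "\<not> faithful_monoid_module (twisted_partition_monoid n) (twisted_action n n)
      (V_plus n :: 'k subset_vector set)"
    using not_inj_on_twisted_action_V_plus[OF n n]
    by (simp add: faithful_monoid_module_def twisted_partition_monoid_def endo_monoid_def)
  show "\<not> faithful_monoid_module (twisted_partition_monoid n) (twisted_action n n)
      (V_minus n :: 'k subset_vector set)"
    using not_inj_on_twisted_action_V_minus[OF n n]
    by (simp add: faithful_monoid_module_def twisted_partition_monoid_def endo_monoid_def)
next
  have obj: "1 \<in> Obj twisted_partition_category"
    by (simp add: twisted_partition_category_def)
  show "\<not> faithful_category_module twisted_partition_category twisted_action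
      (V_plus :: nat \<Rightarrow> 'k subset_vector set)"
    unfolding faithful_category_module_def
    using obj not_inj_on_twisted_action_V_plus[OF zero_less_one zero_less_one] by blast
  show "\<not> faithful_category_module twisted_partition_category twisted_action
      (V_minus :: nat \<Rightarrow> 'k subset_vector set)"
    unfolding faithful_category_module_def
    using obj not_inj_on_twisted_action_V_minus[OF zero_less_one zero_less_one] by blast
qed

end
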